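(* For $\mu\in(-\pi,\pi)$ and $k=0,1,2,\dots$, \[ \mathcal{Z}(k;\mu):=\sum_{m\in\mathbb{Z}}\frac{(-1)^m}{((2m+1)\pi-\mu)^{k+1}}=\frac{1}{2\cdot k!}\,i^k e^{i\mu/2}\,\mathcal{E}_k\big(1/2;e^{i\mu}\big), \] where $\mathcal{E}_k(x;\lambda)$ are the Apostol-Euler polynomials.
   Context: For $\lambda\in\mathbb{C}\setminus\{0,-1\}$, the Apostol-Euler polynomials $\mathcal{E}_k(x;\lambda)$ are defined by the generating function $\frac{2e^{xz}}{\lambda e^z+1}=\sum_{k=0}^\infty \mathcal{E}_k(x;\lambda)\frac{z^k}{k!}$, a power series in $z$ convergent in a neighborhood of $z=0$. The sum over $m\in\mathbb{Z}$ means $\sum_{m\ge 0}+\sum_{m\le -1}$. *)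

theory Defs
  imports "HOL-Analysis.Analysis"
begin

(* For l \<noteq> -1 the denominator has constant term l + 1 \<noteq> 0, so the quotient is the Taylor
   series at 0 of the generating function; see apostol_euler_generating_function. *)
definition apostol_euler :: "nat \<Rightarrow> complex \<Rightarrow> complex \<Rightarrow> complex" where
  "apostol_euler k x l =
     fact k * fps_nth (2 * fps_exp x / (fps_const l * fps_exp 1 + 1)) k"

lemma apostol_euler_generating_function:
  fixes x l :: complex
  assumes "l \<noteq> -1"
  shows "\<forall>\<^sub>F z in nhds 0.
           (\<lambda>k. apostol_euler k x l * (z ^ k / fact k)) sums (2 * exp (x * z) / (l * exp z + 1))"
proof -
  define N D where "N = 2 * fps_exp x" and "D = fps_const l * fps_exp 1 + 1"
  have D0: "fps_nth D 0 \<noteq> 0"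
    using assms by (simp add: D_def eq_neg_iff_add_eq_0)
  have "(\<lambda>z. 2 * exp (x * z) * inverse (l * exp z + 1)) has_fps_expansion N * inverse D"
    using D0 unfolding N_def D_def by (intro fps_expansion_intros)
  moreover have "N * inverse D = N / D"
    using D0 by (simp add: fps_divide_unit)
  ultimately have *: "(\<lambda>z. 2 * exp (x * z) / (l * exp z + 1)) has_fps_expansion N / D"
    by (simp add: divide_inverse)
  have "\<forall>\<^sub>F z in nhds 0. z \<in> eball 0 (fps_conv_radius (N / D))"
    using * by (intro eventually_nhds_in_open) (auto simp: has_fps_expansion_def zero_ereal_def)
  moreover have "\<forall>\<^sub>F z in nhds 0. eval_fps (N / D) z = 2 * exp (x * z) / (l * exp z + 1)"
    using * by (simp add: has_fps_expansion_def)
  ultimately show ?thesis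
  proof eventually_elim
    case (elim z)
    have "(\<lambda>k. fps_nth (N / D) k * z ^ k) sums eval_fps (N / D) z"
      using elim(1) by (intro sums_eval_fps) simp
    then show ?case
      using elim(2) by (simp add: apostol_euler_def N_def D_def)
  qed
qed

definition zeta_Z_term :: "nat \<Rightarrow> real \<Rightarrow> int \<Rightarrow> real" where
  "zeta_Z_term k \<mu> m = (-1) powi m / ((2 * of_int m + 1) * pi - \<mu>) ^ (k + 1)"

(* For k = 0 the sum over the integers converges only conditionally; it is read as the sum over
   m \<ge> 0 plus the sum over m \<le> -1 (with m = - int n - 1), each in order of increasing |m|. *)
definition zeta_Z :: "nat \<Rightarrow> real \<Rightarrow> real" where
  "zeta_Z k \<mu> = (\<Sum>n. zeta_Z_term k \<mu> (int n)) + (\<Sum>n. zeta_Z_term k \<mu> (- int n - 1))"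

end

theory Submission
  imports Defs "HOL-Probability.Characteristic_Functions" "HOL-Real_Asymp.Real_Asymp"
begin

text \<open>
  Grouping consecutive terms in pairs, the two halves of the series are differences of polygamma
  functions at \<open>1/4 \<plusminus> \<mu>/(4\<pi>)\<close> and \<open>3/4 \<plusminus> \<mu>/(4\<pi>)\<close>. For \<open>k = 0\<close> the reflection formula
  \<open>\<psi>(1 - z) - \<psi>(z) = \<pi> cot(\<pi>z)\<close> evaluates their sum to \<open>1 / (2 cos(\<mu>/2))\<close>. Differentiating in \<open>\<mu>\<close>
  turns the sum for \<open>k\<close> into \<open>k + 1\<close> times the sum for \<open>k + 1\<close>, so the sums are the Taylor
  coefficients of \<open>1 / (2 cos(w/2))\<close> at \<open>\<mu>\<close>. With \<open>w = \<mu> - \<i>z\<close> this function is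
  \<open>exp(\<i>\<mu>/2) / 2\<close> times the generating function of the Apostol-Euler polynomials at \<open>x = 1/2\<close>.
\<close>

section \<open>Summation in pairs, and polygamma identities\<close>

text \<open>The paired series controls the partial sums of even length; one of odd length has one
  more term, which tends to 0. This covers series that converge only conditionally.\<close>

lemma sums_of_sums_pairs:
  fixes f :: "nat \<Rightarrow> 'a :: real_normed_vector"
  assumes "f \<longlonglongrightarrow> 0" and "(\<lambda>j. f (2 * j) + f (2 * j + 1)) sums s"
  shows "f sums s"
proof -
  have eq: "(\<Sum>j<n. f (2 * j) + f (2 * j + 1)) = (\<Sum>i<2 * n. f i)" for n
    by (induction n) (auto simp: algebra_simps)
  have even: "(\<lambda>n. \<Sum>i<2 * n. f i) \<longlonglongrightarrow> s"
    using assms(2) by (simp add: sums_def flip: eq)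
  have "(\<lambda>n. f (2 * n)) \<longlonglongrightarrow> 0"
    using LIMSEQ_subseq_LIMSEQ[OF assms(1), of "\<lambda>n. 2 * n"]
    by (simp add: o_def strict_mono_def)
  from tendsto_add[OF even this] have "(\<lambda>n. \<Sum>i<2 * n + 1. f i) \<longlonglongrightarrow> s"
    by simp
  with even show ?thesis
    unfolding sums_def by (rule limseq_even_odd)
qed

text \<open>For \<open>k > 0\<close> the two series converge separately. For \<open>k = 0\<close>
  they do not, but the harmonic terms in the two \<open>Digamma\<close> series cancel, and so does
  \<open>euler_mascheroni\<close>.\<close>

lemma Polygamma_diff_sums:
  fixes a b :: "'a :: {real_normed_field, banach}"
  assumes "a \<noteq> 0" "b \<noteq> 0"
  shows "(\<lambda>j. 1 / (a + of_nat j) ^ Suc k - 1 / (b + of_nat j) ^ Suc k) sums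
           ((-1) ^ Suc k / fact k * (Polygamma k a - Polygamma k b))"
proof (cases "k = 0")
  case True
  have "(\<lambda>j. inverse (of_nat (Suc j)) - inverse (z + of_nat j)) sums (Digamma z + euler_mascheroni)"
    if "z \<noteq> 0" for z :: 'a
    using summable_sums[OF summable_Digamma[OF that]] by (simp add: Digamma_def)
  from sums_diff[OF this[OF assms(2)] this[OF assms(1)]] show ?thesis
    using True by (simp add: field_simps)
next
  case False
  then show ?thesis
    using sums_diff[OF Polygamma_LIMSEQ[OF assms(1), of k] Polygamma_LIMSEQ[OF assms(2), of k]]
    by (simp add: divide_inverse algebra_simps)
qed

text \<open>This is the logarithmic derivative of the reflection formula
  \<open>rGamma z * rGamma (1 - z) = sin (pi * z) / pi\<close>.\<close>

lemma Digamma_reflection_complex: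
  fixes z :: complex
  assumes "z \<notin> \<int>"
  shows "Digamma (1 - z) - Digamma z = of_real pi * cot (of_real pi * z)"
proof -
  have z: "z \<notin> \<int>\<^sub>\<le>\<^sub>0" "1 - z \<notin> \<int>\<^sub>\<le>\<^sub>0"
    using assms Ints_diff[of 1 "1 - z"] by (auto dest: nonpos_Ints_Int)
  have "((\<lambda>z. rGamma z * rGamma (1 - z)) has_field_derivative
          (rGamma z * rGamma (1 - z)) * (Digamma (1 - z) - Digamma z)) (at z)"
    using z by (auto intro!: derivative_eq_intros simp: algebra_simps)
  moreover have "((\<lambda>z. sin (of_real pi * z) / of_real pi) has_field_derivative
          cos (of_real pi * z)) (at z)"
    by (auto intro!: derivative_eq_intros)
  ultimately have "sin (of_real pi * z) / of_real pi * (Digamma (1 - z) - Digamma z)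
      = cos (of_real pi * z)"
    unfolding rGamma_reflection_complex by (rule DERIV_unique)
  moreover have "sin (of_real pi * z) \<noteq> 0"
    using assms by (auto simp: sin_eq_0)
  ultimately show ?thesis
    by (simp add: cot_def field_simps)
qed

section \<open>Taylor coefficients of \<open>1 / (2 * cos (w / 2))\<close>\<close>

text \<open>The factors \<open>Suc k\<close> accumulate to \<open>fact k\<close>, so
  \<open>F k z\<close> is the \<open>k\<close>-th Taylor coefficient of \<open>F 0\<close> at
  \<open>z\<close>. Openness of \<open>S\<close> allows the induction hypothesis to be
  differentiated.\<close>

lemma higher_deriv_of_scaled_derivatives:
  fixes F :: "nat \<Rightarrow> 'a :: real_normed_field \<Rightarrow> 'a"
  assumes "open S" "z \<in> S"
    and "\<And>k z. z \<in> S \<Longrightarrow> (F k has_field_derivative of_nat (Suc k) * F (Suc k) z) (at z)"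
  shows "(deriv ^^ k) (F 0) z = fact k * F k z"
  using assms(2)
proof (induction k arbitrary: z)
  case (Suc k)
  have "((\<lambda>z. fact k * F k z) has_field_derivative fact k * (of_nat (Suc k) * F (Suc k) z)) (at z)"
    by (intro DERIV_cmult assms(3) Suc.prems)
  then have "((deriv ^^ k) (F 0) has_field_derivative fact k * (of_nat (Suc k) * F (Suc k) z)) (at z)"
    by (rule has_field_derivative_transform_within_open[OF _ assms(1) Suc.prems])
       (simp add: Suc.IH)
  then show ?case
    by (simp add: DERIV_imp_deriv algebra_simps)
qed simp

text \<open>The closed form of the sum for \<open>k\<close>; its two polygamma differences come from
  m \<ge> 0 and m \<le> -1. The argument is complex because it is later moved to
  \<open>\<mu> - \<i> * z\<close>.\<close>

definition half_sec_coeff :: "nat \<Rightarrow> complex \<Rightarrow> complex" where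
  "half_sec_coeff k w = (-1) ^ Suc k / (fact k * of_real (4 * pi) ^ Suc k) *
     ((Polygamma k (1/4 - w / of_real (4 * pi)) - Polygamma k (3/4 - w / of_real (4 * pi))) +
      (-1) ^ k * (Polygamma k (1/4 + w / of_real (4 * pi)) - Polygamma k (3/4 + w / of_real (4 * pi))))"

lemma not_nonpos_Ints_of_Re_pos: "Re z > 0 \<Longrightarrow> z \<notin> \<int>\<^sub>\<le>\<^sub>0"
  by (auto elim!: nonpos_Ints_cases)

text \<open>The bound on \<open>Re w\<close> keeps all four polygamma arguments in the right
  half-plane, away from the poles.\<close>

lemma has_field_derivative_half_sec_coeff:
  assumes "\<bar>Re w\<bar> < pi"
  shows "(half_sec_coeff k has_field_derivative of_nat (Suc k) * half_sec_coeff (Suc k) w) (at w)"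
proof -
  define c :: complex where "c = of_real (4 * pi)"
  have c: "c \<noteq> 0" by (simp add: c_def)
  have Re: "Re (w / c) = Re w / (4 * pi)"
    unfolding c_def by (rule Re_divide_of_real)
  have "\<bar>Re (w / c)\<bar> < 1 / 4"
    using assms by (simp add: Re field_simps abs_less_iff)
  then have ni: "1/4 - w / c \<notin> \<int>\<^sub>\<le>\<^sub>0" "3/4 - w / c \<notin> \<int>\<^sub>\<le>\<^sub>0"
      "1/4 + w / c \<notin> \<int>\<^sub>\<le>\<^sub>0" "3/4 + w / c \<notin> \<int>\<^sub>\<le>\<^sub>0"
    by (auto intro!: not_nonpos_Ints_of_Re_pos)
  have P: "((\<lambda>w. Polygamma k (a + s * (w / c))) has_field_derivative
      s / c * Polygamma (Suc k) (a + s * (w / c))) (at w)"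
    if "a + s * (w / c) \<notin> \<int>\<^sub>\<le>\<^sub>0" for a s
    using that c
    by (auto intro!: derivative_eq_intros DERIV_chain2[OF has_field_derivative_Polygamma]
        simp: field_simps)
  have coeff: "half_sec_coeff j v = (-1) ^ Suc j / (fact j * c ^ Suc j) *
      ((Polygamma j (1/4 + (-1) * (v / c)) - Polygamma j (3/4 + (-1) * (v / c))) +
       (-1) ^ j * (Polygamma j (1/4 + 1 * (v / c)) - Polygamma j (3/4 + 1 * (v / c))))" for j v
    by (simp add: half_sec_coeff_def c_def)
  \<comment> \<open>The inner derivative \<open>-1 / c\<close> of the first pair moves into the
    prefactor, which flips the relative sign of the second pair; \<open>Suc k\<close> cancels
    against \<open>fact (Suc k)\<close>.\<close>
  have scale: "(-1) ^ Suc k / (fact k * c ^ Suc k) *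
      (((-1) / c * P - (-1) / c * Q) + (-1) ^ k * (1 / c * R - 1 / c * T)) =
      of_nat (Suc k) * ((-1) ^ Suc (Suc k) / (fact (Suc k) * c ^ Suc (Suc k)) *
        ((P - Q) + (-1) ^ Suc k * (R - T)))" for P Q R T
    using c by (simp add: fact_Suc field_simps del: of_nat_Suc)
  show ?thesis
    unfolding coeff[abs_def] scale [symmetric]
    by (intro DERIV_cmult DERIV_add DERIV_diff P) (use ni in simp_all)
qed

text \<open>Since \<open>3/4 - u = 1 - (1/4 + u)\<close> and \<open>3/4 + u = 1 - (1/4 - u)\<close>,
  the reflection formula applies to both cross pairs. The resulting cotangents belong to
  complementary angles.\<close>

lemma half_sec_coeff_0:
  assumes "\<bar>Re w\<bar> < pi"
  shows "half_sec_coeff 0 w = 1 / (2 * cos (w / 2))"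
proof -
  define u where "u = w / of_real (4 * pi)"
  have "Re u = Re w / (4 * pi)"
    unfolding u_def by (rule Re_divide_of_real)
  then have u: "\<bar>Re u\<bar> < 1 / 4"
    using assms by (simp add: abs_divide divide_less_eq)
  have ni: "z \<notin> \<int>" if "0 < Re z" "Re z < 1" for z :: complex
    using that by (auto elim!: Ints_cases)
  have 1: "Digamma (3/4 - u) - Digamma (1/4 + u) = of_real pi * cot (of_real pi * (1/4 + u))"
    using Digamma_reflection_complex[of "1/4 + u"] u ni[of "1/4 + u"] by (simp add: algebra_simps)
  have 2: "Digamma (3/4 + u) - Digamma (1/4 - u) = of_real pi * cot (of_real pi * (1/4 - u))"
    using Digamma_reflection_complex[of "1/4 - u"] u ni[of "1/4 - u"] by (simp add: algebra_simps)
  define a where "a = of_real pi * (1/4 + u)"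
  have b: "of_real pi * (1/4 - u) = of_real pi / 2 - a"
    by (simp add: a_def algebra_simps)
  have a2: "2 * a = of_real pi / 2 + w / 2"
    by (simp add: a_def u_def field_simps)
  have "half_sec_coeff 0 w = 1 / of_real (4 * pi) *
      ((Digamma (3/4 + u) - Digamma (1/4 - u)) + (Digamma (3/4 - u) - Digamma (1/4 + u)))"
    by (simp add: half_sec_coeff_def u_def field_simps)
  also have "\<dots> = (cot a + cot (of_real pi / 2 - a)) / 4"
    unfolding 1 2 b by (simp add: a_def field_simps)
  also have "\<dots> = 1 / (2 * sin (2 * a))"
  proof (cases "sin a = 0 \<or> cos a = 0")
    case False
    have cot_b: "cot (of_real pi / 2 - a) = sin a / cos a"
      by (simp add: cot_def sin_diff cos_diff)
    have "cot a + cot (of_real pi / 2 - a) = (sin a ^ 2 + cos a ^ 2) / (sin a * cos a)"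
      unfolding cot_b unfolding cot_def using False
      by (simp add: add_frac_eq power2_eq_square add.commute del: sin_cos_squared_add)
    then show ?thesis using False by (simp add: sin_double)
  \<comment> \<open>If \<open>sin a\<close> or \<open>cos a\<close> vanishes, both sides are 0, as
    division by 0 gives 0.\<close>
  qed (auto simp: cot_def sin_diff cos_diff sin_double)
  also have "sin (2 * a) = cos (w / 2)"
    unfolding a2 by (simp add: sin_add)
  finally show ?thesis .
qed

section \<open>Evaluation of the alternating series\<close>

text \<open>Taking \<open>4 * pi\<close> out of the terms with indices \<open>2 * j\<close> and
  \<open>2 * j + 1\<close> leaves the shifts \<open>1/4\<close> and \<open>3/4\<close> of a
  polygamma difference. Both halves of the sum over the integers are instances, with
  \<open>x = -\<mu>\<close> and \<open>x = \<mu>\<close>.\<close>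

lemma alternating_odd_pi_shift_sums:
  fixes x :: real
  assumes "\<bar>x\<bar> < pi"
  shows "(\<lambda>n. (-1) ^ n / ((2 * real n + 1) * pi + x) ^ Suc k) sums
           ((-1) ^ Suc k / (fact k * (4 * pi) ^ Suc k) *
             (Polygamma k (1/4 + x / (4 * pi)) - Polygamma k (3/4 + x / (4 * pi))))"
proof (rule sums_of_sums_pairs)
  define c where "c = 4 * pi"
  have c: "c > 0" by (simp add: c_def)
  have "\<bar>x / c\<bar> < 1 / 4"
    using assms by (simp add: c_def field_simps abs_less_iff)
  then have "1/4 + x / c \<noteq> 0" "3/4 + x / c \<noteq> 0" by linarith+
  from sums_mult[OF Polygamma_diff_sums[OF this, of k], of "1 / c ^ Suc k"]
  have "(\<lambda>j. 1 / (c * (1/4 + x / c + real j)) ^ Suc k - 1 / (c * (3/4 + x / c + real j)) ^ Suc k) sums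
       ((-1) ^ Suc k / (fact k * c ^ Suc k) * (Polygamma k (1/4 + x / c) - Polygamma k (3/4 + x / c)))"
    by (simp add: power_mult_distrib right_diff_distrib mult.commute del: power_Suc)
  moreover have "c * (1/4 + x / c + real j) = (2 * real (2 * j) + 1) * pi + x"
      "c * (3/4 + x / c + real j) = (2 * real (2 * j + 1) + 1) * pi + x" for j
    using c by (simp_all add: c_def field_simps)
  ultimately show "(\<lambda>j. (-1) ^ (2 * j) / ((2 * real (2 * j) + 1) * pi + x) ^ Suc k +
      (-1) ^ (2 * j + 1) / ((2 * real (2 * j + 1) + 1) * pi + x) ^ Suc k) sums
      ((-1) ^ Suc k / (fact k * (4 * pi) ^ Suc k) *
             (Polygamma k (1/4 + x / (4 * pi)) - Polygamma k (3/4 + x / (4 * pi))))"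
    by (simp add: c_def del: power_Suc)
  have "filterlim (\<lambda>n. ((2 * real n + 1) * pi + x) ^ Suc k) at_top sequentially"
    by (intro filterlim_pow_at_top) (simp, real_asymp)
  from tendsto_norm_zero[OF tendsto_divide_0[OF tendsto_const[of 1]
        filterlim_at_top_imp_at_infinity[OF this]]]
  have "(\<lambda>n. norm ((-1) ^ n / ((2 * real n + 1) * pi + x) ^ Suc k)) \<longlonglongrightarrow> 0"
    by (simp only: norm_divide norm_power norm_minus_cancel norm_one power_one)
  then show "(\<lambda>n. (-1) ^ n / ((2 * real n + 1) * pi + x) ^ Suc k) \<longlonglongrightarrow> 0"
    by (rule tendsto_norm_zero_cancel)
qed

lemma zeta_Z_eq_half_sec_coeff:
  assumes "\<bar>\<mu>\<bar> < pi"
  shows "summable (\<lambda>n. zeta_Z_term k \<mu> (int n))"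
    and "summable (\<lambda>n. zeta_Z_term k \<mu> (- int n - 1))"
    and "complex_of_real (zeta_Z k \<mu>) = half_sec_coeff k (of_real \<mu>)"
proof -
  define A where "A x = (-1) ^ Suc k / (fact k * (4 * pi) ^ Suc k) *
             (Polygamma k (1/4 + x / (4 * pi)) - Polygamma k (3/4 + x / (4 * pi)))" for x :: real
  have "(\<lambda>n. zeta_Z_term k \<mu> (int n)) = (\<lambda>n. (-1) ^ n / ((2 * real n + 1) * pi + (- \<mu>)) ^ Suc k)"
    by (simp add: zeta_Z_term_def fun_eq_iff)
  then have 1: "(\<lambda>n. zeta_Z_term k \<mu> (int n)) sums A (-\<mu>)"
    unfolding A_def using alternating_odd_pi_shift_sums[of "-\<mu>" k] assms by simp
  \<comment> \<open>The numerator has sign \<open>(-1) ^ Suc n\<close> and the negated base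
    contributes \<open>(-1) ^ Suc k\<close>; together they give
    \<open>(-1) ^ k * (-1) ^ n\<close>.\<close>
  have "zeta_Z_term k \<mu> (- int n - 1) = (-1) ^ k * ((-1) ^ n / ((2 * real n + 1) * pi + \<mu>) ^ Suc k)" for n
  proof -
    have "- int n - 1 = - int (Suc n)" by simp
    then have s: "(-1 :: real) powi (- int n - 1) = (-1) ^ Suc n"
      by (simp only: power_int_minus power_int_of_nat flip: power_inverse) simp
    have "(2 * of_int (- int n - 1) + 1) * pi - \<mu> = - 1 * ((2 * real n + 1) * pi + \<mu>)"
      by (simp add: algebra_simps)
    then show ?thesis
      unfolding zeta_Z_term_def s by (simp only: power_mult_distrib) (cases "even k"; simp)
  qed
  then have 2: "(\<lambda>n. zeta_Z_term k \<mu> (- int n - 1)) sums ((-1) ^ k * A \<mu>)"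
    unfolding A_def using sums_mult[OF alternating_odd_pi_shift_sums[of \<mu> k], of "(-1) ^ k"] assms
    by simp
  show "summable (\<lambda>n. zeta_Z_term k \<mu> (int n))" "summable (\<lambda>n. zeta_Z_term k \<mu> (- int n - 1))"
    using 1 2 by (auto simp: sums_iff)
  have "\<bar>\<mu> / (4 * pi)\<bar> < 1 / 4"
    using assms by (simp add: field_simps abs_less_iff)
  then have nz: "1/4 - \<mu> / (4 * pi) \<noteq> 0" "3/4 - \<mu> / (4 * pi) \<noteq> 0"
      "1/4 + \<mu> / (4 * pi) \<noteq> 0" "3/4 + \<mu> / (4 * pi) \<noteq> 0"
    by linarith+
  have "zeta_Z k \<mu> = A (-\<mu>) + (-1) ^ k * A \<mu>"
    using 1 2 by (simp add: zeta_Z_def sums_iff)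
  also have "\<dots> = (-1) ^ Suc k / (fact k * (4 * pi) ^ Suc k) *
     ((Polygamma k (1/4 - \<mu> / (4 * pi)) - Polygamma k (3/4 - \<mu> / (4 * pi))) +
      (-1) ^ k * (Polygamma k (1/4 + \<mu> / (4 * pi)) - Polygamma k (3/4 + \<mu> / (4 * pi))))"
    by (simp add: A_def algebra_simps)
  also have "complex_of_real \<dots> = half_sec_coeff k (of_real \<mu>)"
    using nz[THEN Polygamma_of_real[where 'a = complex, of _ k]] by (simp add: half_sec_coeff_def)
  finally show "complex_of_real (zeta_Z k \<mu>) = half_sec_coeff k (of_real \<mu>)" .
qed

section \<open>Comparison with the Apostol-Euler polynomials\<close>

lemma apostol_euler_half:
  assumes "\<bar>\<mu>\<bar> < pi"
  shows "apostol_euler k (1 / 2) (exp (\<i> * of_real \<mu>)) =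
           2 * fact k * exp (- \<i> * of_real \<mu> / 2) * (- \<i>) ^ k * half_sec_coeff k (of_real \<mu>)"
proof -
  define l where "l = exp (\<i> * of_real \<mu>)"
  define h where "h z = 2 * exp (1 / 2 * z) * inverse (l * exp z + 1)" for z :: complex
  \<comment> \<open>\<open>H k\<close> is the intended \<open>k\<close>-th Taylor coefficient of
    \<open>h\<close> as a function of the base point; \<open>(- \<i>) ^ k\<close> collects the inner
    derivatives of \<open>\<mu> - \<i> * z\<close>.\<close>
  define H where "H k z = 2 * exp (- \<i> * of_real \<mu> / 2) * (- \<i>) ^ k * half_sec_coeff k (of_real \<mu> - \<i> * z)"
    for k z
  define S where "S = {z. \<bar>Re (of_real \<mu> - \<i> * z)\<bar> < pi}"
  have S: "open S" "0 \<in> S"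
    using assms by (auto simp: S_def intro!: open_Collect_less continuous_intros)
  have h_eq: "h z = H 0 z" if "z \<in> S" for z
  proof -
    define e where "e = exp (\<i> * (of_real \<mu> - \<i> * z) / 2)"
    have e: "e = exp (\<i> * of_real \<mu> / 2) * exp (1 / 2 * z)"
      by (simp add: e_def exp_add [symmetric] algebra_simps add_divide_distrib diff_divide_distrib)
    have e2: "l * exp z = e ^ 2"
      by (simp add: e l_def power_mult_distrib exp_double [symmetric])
    have cos_e: "2 * cos ((of_real \<mu> - \<i> * z) / 2) = e + inverse e"
      by (simp add: cos_exp_eq e_def exp_minus)
    have "\<bar>Re (of_real \<mu> - \<i> * z)\<bar> < pi"
      using that by (simp add: S_def)
    then have "half_sec_coeff 0 (of_real \<mu> - \<i> * z) = 1 / (e + inverse e)"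
      by (simp only: half_sec_coeff_0 cos_e)
    also have "\<dots> = e / (e ^ 2 + 1)"
      \<comment> \<open>If \<open>e ^ 2 + 1 = 0\<close>, then \<open>e + inverse e = 0\<close> as
        well, and both quotients are 0.\<close>
      by (cases "e ^ 2 + 1 = 0") (auto simp: e_def field_simps power2_eq_square)
    finally have "H 0 z = 2 * (exp (- \<i> * of_real \<mu> / 2) * e) / (l * exp z + 1)"
      by (simp add: H_def e2)
    also have "exp (- \<i> * of_real \<mu> / 2) * e = exp (1 / 2 * z)"
      by (simp add: e exp_minus)
    finally show ?thesis by (simp only: h_def divide_inverse)
  qed
  have cos_nz: "cos (\<mu> / 2) \<noteq> 0"
    using assms by (intro less_imp_neq[symmetric] cos_gt_zero_pi) auto
  \<comment> \<open>This makes the constant term \<open>l + 1\<close> of the denominator nonzero, so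
    the formal quotient is the power series of \<open>h\<close> at 0.\<close>
  have "l \<noteq> -1"
  proof
    assume "l = -1"
    then have "cos (2 * (\<mu> / 2)) = -1"
      by (simp add: l_def complex_eq_iff Re_exp)
    with cos_nz show False
      unfolding cos_double_cos by simp
  qed
  then have D0: "fps_nth (fps_const l * fps_exp 1 + 1) 0 \<noteq> 0"
    by (simp add: eq_neg_iff_add_eq_0)
  have "h has_fps_expansion 2 * fps_exp (1 / 2) * inverse (fps_const l * fps_exp 1 + 1)"
    unfolding h_def using D0 by (intro fps_expansion_intros)
  then have "h has_fps_expansion 2 * fps_exp (1 / 2) / (fps_const l * fps_exp 1 + 1)"
    using D0 by (simp add: fps_divide_unit)
  then have "fps_nth (2 * fps_exp (1 / 2) / (fps_const l * fps_exp 1 + 1)) k = (deriv ^^ k) h 0 / fact k"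
    by (rule fps_nth_fps_expansion)
  also have "(deriv ^^ k) h 0 = (deriv ^^ k) (H 0) 0"
    by (intro higher_deriv_cong_ev eventually_mono[OF eventually_nhds_in_open[OF S]] h_eq refl)
  also have "\<dots> = fact k * H k 0"
  proof (rule higher_deriv_of_scaled_derivatives[OF S])
    fix k z
    assume "z \<in> S"
    then have "(half_sec_coeff k has_field_derivative
        of_nat (Suc k) * half_sec_coeff (Suc k) (of_real \<mu> - \<i> * z)) (at (of_real \<mu> - \<i> * z))"
      by (intro has_field_derivative_half_sec_coeff) (simp add: S_def)
    then have "((\<lambda>z. half_sec_coeff k (of_real \<mu> - \<i> * z)) has_field_derivative
        of_nat (Suc k) * half_sec_coeff (Suc k) (of_real \<mu> - \<i> * z) * (- \<i>)) (at z)"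
      by (rule DERIV_chain2) (auto intro!: derivative_eq_intros)
    from DERIV_cmult[OF this, of "2 * exp (- \<i> * of_real \<mu> / 2) * (- \<i>) ^ k"]
    show "(H k has_field_derivative of_nat (Suc k) * H (Suc k) z) (at z)"
      unfolding H_def by (simp add: algebra_simps)
  qed
  finally show ?thesis
    by (simp add: apostol_euler_def H_def flip: l_def)
qed

theorem theorem3:
  fixes \<mu> :: real and k :: nat
  assumes "\<mu> \<in> {-pi<..<pi}"
  shows "summable (\<lambda>n. zeta_Z_term k \<mu> (int n)) \<and>
         summable (\<lambda>n. zeta_Z_term k \<mu> (- int n - 1)) \<and>
         complex_of_real (zeta_Z k \<mu>) =
           1 / (2 * fact k) * \<i> ^ k * exp (\<i> * of_real \<mu> / 2)
             * apostol_euler k (1 / 2) (exp (\<i> * of_real \<mu>))"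
proof -
  have \<mu>: "\<bar>\<mu>\<bar> < pi" using assms by auto
  \<comment> \<open>The power of \<open>\<i>\<close> and the exponential in the claim are inverse to
    those in \<open>apostol_euler_half\<close>, so only \<open>half_sec_coeff\<close>
    remains.\<close>
  have "\<i> ^ k * (- \<i>) ^ k = 1"
    by (simp flip: power_mult_distrib)
  moreover have "exp (\<i> * of_real \<mu> / 2) * exp (- \<i> * of_real \<mu> / 2) = 1"
    by (simp flip: exp_add)
  ultimately have "1 / (2 * fact k) * \<i> ^ k * exp (\<i> * of_real \<mu> / 2)
      * apostol_euler k (1 / 2) (exp (\<i> * of_real \<mu>)) = half_sec_coeff k (of_real \<mu>)"
    unfolding apostol_euler_half[OF \<mu>] by (simp add: mult_ac)
  then show ?thesis
    using zeta_Z_eq_half_sec_coeff[OF \<mu>, of k] by simp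
qed

end
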